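(* There is $\varepsilon>0$ such that, whenever $0<Kh<\varepsilon$, where $K$ is the wave number and $h$ is the mesh size, the difference scheme $$\mathcal{L}_{i,j}U_{i,j}=F_{i,j},\qquad 1\le i,j\le N-1,$$ with prescribed Dirichlet boundary values $U_{i,j}=\Phi(x_i,y_j)$ for $(x_i,y_j)\in\partial\Omega_h$, has a unique solution $U$.
   Context: Consider the problem $\partial_x^2u+\partial_y^2u+K^2u=f$ in $\Omega=[a,b]\times[c,d]$, $u=\Phi$ on $\partial\Omega$, with constant wave number $K$ and known sufficiently smooth $f$. The grid $\Omega_h$ consists of the points $(x_i,y_j)$, $x_i=a+ih$, $y_j=c+jh$, $0\le i,j\le N$ (uniform step $h$, with $x_N=b$, $y_N=d$); interior points are those with $1\le i,j\le N-1$, and $\partial\Omega_h$ is the set of remaining (boundary) grid points. For grid functions (and functions evaluated on the grid), $\delta_x^2\varphi_{i,j}=\frac{\varphi_{i-1,j}-2\varphi_{i,j}+\varphi_{i+1,j}}{h^2}$, $\delta_y^2\varphi_{i,j}=\frac{\varphi_{i,j-1}-2\varphi_{i,j}+\varphi_{i,j+1}}{h^2}$, and $\delta_x^2\delta_y^2$ is their composition. The operator is $$\mathcal{L}=-\alpha_1(\delta_x^2+\delta_y^2)-\alpha_2\delta_x^2\delta_y^2-K^2\alpha_3$$ and $$F_{i,j}=-\beta_1f_{i,j}-\beta_2(\delta_x^2+\delta_y^2)f_{i,j}-\beta_3\delta_x^2\delta_y^2f_{i,j}-\beta_4(\partial_x^2+\partial_y^2)f_{i,j}-\beta_5(\delta_x^2\partial_x^2+\delta_y^2\partial_y^2)f_{i,j},$$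 with $\alpha_1=1+\frac{K^6h^6}{20160}$, $\alpha_2=\frac{h^2}{6}\left(1+\frac{K^2h^2}{30}+\frac{K^4h^4}{840}\right)$, $\alpha_3=1-\frac{K^2h^2}{12}+\frac{K^4h^4}{360}$, $\beta_1=1-\frac{K^2h^2}{12}+\frac{K^4h^4}{360}$, $\beta_2=\frac{K^4h^6}{20160}$, $\beta_3=\frac{h^4}{90}\left(1+\frac{K^2h^2}{112}\right)$, $\beta_4=\frac{h^2}{12}\left(1-\frac{K^2h^2}{30}\right)$, $\beta_5=\frac{h^4}{360}\left(1-\frac{K^2h^2}{56}\right)$. *)

theory Defs
  imports "HOL-Analysis.Analysis"
begin

text \<open>
  Partial derivatives on the closed rectangle \<open>{a..b} \<times> {c..d}\<close>. They are taken within the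
  respective interval, hence are one-sided at the boundary, where the scheme evaluates them too.
\<close>

definition partial_x :: "real \<Rightarrow> real \<Rightarrow> (real \<Rightarrow> real \<Rightarrow> real) \<Rightarrow> real \<Rightarrow> real \<Rightarrow> real" where
  "partial_x a b g x y = vector_derivative (\<lambda>s. g s y) (at x within {a..b})"

definition partial_y :: "real \<Rightarrow> real \<Rightarrow> (real \<Rightarrow> real \<Rightarrow> real) \<Rightarrow> real \<Rightarrow> real \<Rightarrow> real" where
  "partial_y c d g x y = vector_derivative (\<lambda>t. g x t) (at y within {c..d})"

text \<open>\<open>C_on_rect k a b c d g\<close>: \<open>g\<close> is of class \<open>C\<^sup>k\<close> on \<open>{a..b} \<times> {c..d}\<close>, up to the boundary.\<close>

primrec C_on_rect ::
  "nat \<Rightarrow> real \<Rightarrow> real \<Rightarrow> real \<Rightarrow> real \<Rightarrow> (real \<Rightarrow> real \<Rightarrow> real) \<Rightarrow> bool" where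
  "C_on_rect 0 a b c d g = continuous_on ({a..b} \<times> {c..d}) (\<lambda>(x, y). g x y)"
| "C_on_rect (Suc k) a b c d g =
    (continuous_on ({a..b} \<times> {c..d}) (\<lambda>(x, y). g x y) \<and>
     (\<forall>x\<in>{a..b}. \<forall>y\<in>{c..d}.
        (\<lambda>s. g s y) differentiable (at x within {a..b}) \<and>
        (\<lambda>t. g x t) differentiable (at y within {c..d})) \<and>
     C_on_rect k a b c d (partial_x a b g) \<and> C_on_rect k a b c d (partial_y c d g))"

text \<open>
  Grid functions are indexed by pairs \<open>(i, j)\<close> of natural numbers; the grid point is
  \<open>(a + i h, c + j h)\<close>.
\<close>

definition grid :: "nat \<Rightarrow> (nat \<times> nat) set" where
  "grid N = {0..N} \<times> {0..N}"

definition interior_grid :: "nat \<Rightarrow> (nat \<times> nat) set" where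
  "interior_grid N = {1..N - 1} \<times> {1..N - 1}"

definition boundary_grid :: "nat \<Rightarrow> (nat \<times> nat) set" where
  "boundary_grid N = grid N - interior_grid N"

definition on_grid ::
  "real \<Rightarrow> real \<Rightarrow> real \<Rightarrow> (real \<Rightarrow> real \<Rightarrow> real) \<Rightarrow> nat \<times> nat \<Rightarrow> real" where
  "on_grid a c h g = (\<lambda>(i, j). g (a + real i * h) (c + real j * h))"

text \<open>
  Below, \<open>i - 1\<close> and \<open>j - 1\<close> are truncated subtractions. The operators are only used at interior
  indices, where \<open>1 \<le> i\<close> and \<open>1 \<le> j\<close>, so no truncation takes effect.
\<close>

definition delta_x2 :: "real \<Rightarrow> (nat \<times> nat \<Rightarrow> real) \<Rightarrow> nat \<times> nat \<Rightarrow> real" where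
  "delta_x2 h \<phi> = (\<lambda>(i, j). (\<phi> (i - 1, j) - 2 * \<phi> (i, j) + \<phi> (i + 1, j)) / h\<^sup>2)"

definition delta_y2 :: "real \<Rightarrow> (nat \<times> nat \<Rightarrow> real) \<Rightarrow> nat \<times> nat \<Rightarrow> real" where
  "delta_y2 h \<phi> = (\<lambda>(i, j). (\<phi> (i, j - 1) - 2 * \<phi> (i, j) + \<phi> (i, j + 1)) / h\<^sup>2)"

definition alpha1 :: "real \<Rightarrow> real \<Rightarrow> real" where
  "alpha1 K h = 1 + K^6 * h^6 / 20160"

definition alpha2 :: "real \<Rightarrow> real \<Rightarrow> real" where
  "alpha2 K h = h^2 / 6 * (1 + K^2 * h^2 / 30 + K^4 * h^4 / 840)"

definition alpha3 :: "real \<Rightarrow> real \<Rightarrow> real" where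
  "alpha3 K h = 1 - K^2 * h^2 / 12 + K^4 * h^4 / 360"

definition beta1 :: "real \<Rightarrow> real \<Rightarrow> real" where
  "beta1 K h = 1 - K^2 * h^2 / 12 + K^4 * h^4 / 360"

definition beta2 :: "real \<Rightarrow> real \<Rightarrow> real" where
  "beta2 K h = K^4 * h^6 / 20160"

definition beta3 :: "real \<Rightarrow> real \<Rightarrow> real" where
  "beta3 K h = h^4 / 90 * (1 + K^2 * h^2 / 112)"

definition beta4 :: "real \<Rightarrow> real \<Rightarrow> real" where
  "beta4 K h = h^2 / 12 * (1 - K^2 * h^2 / 30)"

definition beta5 :: "real \<Rightarrow> real \<Rightarrow> real" where
  "beta5 K h = h^4 / 360 * (1 - K^2 * h^2 / 56)"

definition scheme_L :: "real \<Rightarrow> real \<Rightarrow> (nat \<times> nat \<Rightarrow> real) \<Rightarrow> nat \<times> nat \<Rightarrow> real" where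
  "scheme_L K h \<phi> p =
     - alpha1 K h * (delta_x2 h \<phi> p + delta_y2 h \<phi> p)
     - alpha2 K h * delta_x2 h (delta_y2 h \<phi>) p
     - K\<^sup>2 * alpha3 K h * \<phi> p"

definition scheme_F ::
  "real \<Rightarrow> real \<Rightarrow> real \<Rightarrow> real \<Rightarrow> real \<Rightarrow> real \<Rightarrow> (real \<Rightarrow> real \<Rightarrow> real) \<Rightarrow> nat \<times> nat \<Rightarrow> real" where
  "scheme_F a b c d K h f p =
     (let fh = on_grid a c h f;
          fxx = on_grid a c h (partial_x a b (partial_x a b f));
          fyy = on_grid a c h (partial_y c d (partial_y c d f))
      in - beta1 K h * fh p
         - beta2 K h * (delta_x2 h fh p + delta_y2 h fh p)
         - beta3 K h * delta_x2 h (delta_y2 h fh) p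
         - beta4 K h * (fxx p + fyy p)
         - beta5 K h * (delta_x2 h fxx p + delta_y2 h fyy p))"

text \<open>
  \<open>U\<close> is a function on the grid only: \<open>extensional\<close> fixes its irrelevant values outside the grid,
  so that equality of solutions is equality at all grid points.
\<close>

definition scheme_solution ::
  "real \<Rightarrow> real \<Rightarrow> real \<Rightarrow> real \<Rightarrow> real \<Rightarrow> nat \<Rightarrow> real \<Rightarrow>
   (real \<Rightarrow> real \<Rightarrow> real) \<Rightarrow> (real \<Rightarrow> real \<Rightarrow> real) \<Rightarrow> (nat \<times> nat \<Rightarrow> real) \<Rightarrow> bool" where
  "scheme_solution a b c d K N h f \<Phi> U \<longleftrightarrow>
     U \<in> extensional (grid N) \<and>
     (\<forall>p\<in>interior_grid N. scheme_L K h U p = scheme_F a b c d K h f p) \<and>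
     (\<forall>p\<in>boundary_grid N. U p = on_grid a c h \<Phi> p)"

end

theory Submission
  imports Defs "HOL-Complex_Analysis.Complex_Singularities"
begin

text \<open>
  The products of discrete sines \<open>sin (\<pi> p i / N) sin (\<pi> q j / N)\<close> vanish on the boundary of the
  grid and are eigenvectors of \<open>\<delta>\<^sub>x\<^sup>2\<close> and \<open>\<delta>\<^sub>y\<^sup>2\<close>, hence of the difference operator. By orthogonality,
  every grid function that vanishes on the boundary is a combination of them. So the discrete
  Dirichlet problem is uniquely solvable as soon as none of the eigenvalues of the operator is zero
  (\<open>discrete_dirichlet_unique_solution\<close>): divide the sine coefficients of the data by the eigenvalues.

  With \<open>L = b - a = N h\<close> and \<open>S = sin\<^sup>2 (\<pi> p h / (2 L))\<close>, \<open>T = sin\<^sup>2 (\<pi> q h / (2 L))\<close>, the eigenvalue times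
  \<open>h\<^sup>2\<close> is
  \<open>4 \<alpha>\<^sub>1 (S + T) - 16 (\<alpha>\<^sub>2 / h\<^sup>2) S T - (K h)\<^sup>2 \<alpha>\<^sub>3\<close>. For \<open>K h \<le> 1\<close> it is positive once \<open>p\<close> or \<open>q\<close> exceeds \<open>K L\<close>,
  since then the part that comes from the second differences outweighs \<open>(K h)\<^sup>2\<close>
  (\<open>scheme_symbol_pos\<close>, \<open>sin_squared_high_frequency\<close>).

  Finitely many frequencies remain. For them an eigenvalue may be very small, because \<open>K\<^sup>2\<close> may be an
  eigenvalue of the continuous Dirichlet problem. However, the displayed expression extends to an
  entire function of \<open>h\<close>. It is not identically zero: at \<open>h = 2 L\<close> both sines vanish and only
  \<open>- (K h)\<^sup>2 \<alpha>\<^sub>3 < 0\<close> is left. Its zeros are therefore isolated, and in particular it has none in some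
  interval \<open>0 < h < \<delta>\<close> (\<open>scheme_symbol_eventually_nonzero\<close>). Both thresholds depend on \<open>K\<close> and \<open>L\<close> only, which are
  given before \<open>\<epsilon>\<close>.
\<close>

section \<open>Orthogonality of the discrete sines\<close>

text \<open>
  Multiplying by \<open>2 sin (t / 2)\<close>, where \<open>t = \<pi> m / N\<close>, makes the sum telescope; the bounds on \<open>m\<close> keep
  this factor nonzero. Only the parity of \<open>m\<close> enters the result, which is what makes the two cosine
  sums in the orthogonality relation below cancel.
\<close>

lemma sum_cos_multiples:
  fixes N m :: nat
  assumes "0 < m" and "m < 2 * N"
  shows "(\<Sum>p<N. cos (real p * (pi * real m / real N))) = (1 - (-1) ^ m) / 2"
proof -
  define t where "t = pi * real m / real N"
  have telescope: "2 * sin (t / 2) * (\<Sum>p<n. cos (real p * t)) = sin ((real n - 1/2) * t) + sin (t / 2)" for n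
  proof (induction n)
    case (Suc n)
    have "2 * sin (t / 2) * cos (real n * t) = sin (t / 2 + real n * t) + sin (t / 2 - real n * t)"
      by (simp add: sin_add sin_diff)
    moreover have "sin (t / 2 - real n * t) = - sin ((real n - 1/2) * t)"
      by (subst sin_minus [symmetric]) (simp add: algebra_simps)
    moreover have "t / 2 + real n * t = (real (Suc n) - 1/2) * t"
      by (simp add: algebra_simps)
    ultimately show ?case
      using Suc by (simp add: distrib_left)
  qed auto
  have "0 < t / 2" "t / 2 < pi"
    using assms by (auto simp: t_def field_simps)
  then have pos: "sin (t / 2) > 0"
    by (simp add: sin_gt_zero)
  have "(real N - 1/2) * t = real m * pi - t / 2"
    using assms by (simp add: t_def field_simps)
  then have "sin ((real N - 1/2) * t) = - ((-1) ^ m * sin (t / 2))"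
    by (simp add: sin_diff cos_npi)
  then have "sin (t / 2) * (2 * (\<Sum>p<N. cos (real p * t))) = sin (t / 2) * (1 - (-1) ^ m)"
    using telescope[of N] by (simp add: algebra_simps)
  then have "2 * (\<Sum>p<N. cos (real p * t)) = 1 - (-1) ^ m"
    using pos by (simp only: mult_cancel_left) simp
  then show ?thesis
    unfolding t_def by simp
qed

definition discrete_sine :: "nat \<Rightarrow> nat \<Rightarrow> nat \<Rightarrow> real" where
  "discrete_sine N p i = sin (real i * (pi * real p / real N))"

lemma discrete_sine_commute: "discrete_sine N p i = discrete_sine N i p"
  by (simp add: discrete_sine_def mult_ac)

lemma discrete_sine_boundary:
  assumes "i = 0 \<or> i = N"
  shows "discrete_sine N p i = 0"
  using assms by (cases "N = 0") (auto simp: discrete_sine_def mult.commute)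

text \<open>
  The product of two sines is half the difference of the cosines at \<open>i - k\<close> and \<open>i + k\<close>. These numbers
  have the same parity, so the two sums agree unless \<open>i = k\<close>, when the first one is \<open>N\<close> and the second
  one, at the even number \<open>2 i\<close>, is \<open>0\<close>.
\<close>

lemma discrete_sine_orthogonal:
  assumes "i \<in> {1..N - 1}" and "k \<in> {1..N - 1}"
  shows "(\<Sum>p\<in>{1..N - 1}. discrete_sine N p i * discrete_sine N p k) = (if i = k then real N / 2 else 0)"
  using assms
proof (induction i k rule: linorder_wlog)
  case (sym i k)
  then show ?case by (simp add: mult.commute)
next
  case (le k i)
  then have N: "N > 0" by auto
  \<comment> \<open>the sum over cosines starts at \<open>0\<close>, where the product of sines vanishes\<close>
  have "(\<Sum>p\<in>{1..N - 1}. discrete_sine N p k * discrete_sine N p i)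
      = (\<Sum>p<N. discrete_sine N p k * discrete_sine N p i)"
  proof (rule sum.mono_neutral_left)
    show "\<forall>p\<in>{..<N} - {1..N - 1}. discrete_sine N p k * discrete_sine N p i = 0"
      by (auto simp: discrete_sine_def not_le)
  qed auto
  also have "\<dots> = (\<Sum>p<N. (cos (real p * (pi * real (i - k) / real N)) - cos (real p * (pi * real (i + k) / real N))) / 2)"
  proof (intro sum.cong refl)
    fix p
    define u v where "u = real k * (pi * real p / real N)" and "v = real i * (pi * real p / real N)"
    have "real p * (pi * real (i - k) / real N) = v - u" "real p * (pi * real (i + k) / real N) = v + u"
      using le N by (simp_all add: u_def v_def of_nat_diff field_simps)
    moreover have "discrete_sine N p k = sin u" "discrete_sine N p i = sin v"
      by (simp_all add: discrete_sine_def u_def v_def)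
    ultimately show "discrete_sine N p k * discrete_sine N p i
        = (cos (real p * (pi * real (i - k) / real N)) - cos (real p * (pi * real (i + k) / real N))) / 2"
      by (simp only: cos_diff cos_add) simp
  qed
  also have "\<dots> = ((\<Sum>p<N. cos (real p * (pi * real (i - k) / real N))) - (1 - (-1) ^ (i + k)) / 2) / 2"
    using le by (subst sum_cos_multiples[symmetric]) (auto simp: sum_subtractf sum_divide_distrib diff_divide_distrib)
  also have "\<dots> = (if k = i then real N / 2 else 0)"
  proof (cases "k = i")
    case True
    then show ?thesis by simp
  next
    case False
    have "(-1::real) ^ (i + k) = (-1) ^ (i - k)"
      using le by (metis (no_types, opaque_lifting) even_diff_nat minus_one_power_iff not_less)
    then show ?thesis
      using False le by (subst sum_cos_multiples) auto
  qed
  finally show ?case .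
qed

section \<open>Diagonalisation of the difference operator\<close>

definition sine_mode :: "nat \<Rightarrow> nat \<times> nat \<Rightarrow> nat \<times> nat \<Rightarrow> real" where
  "sine_mode N = (\<lambda>(p, q) (i, j). discrete_sine N p i * discrete_sine N q j)"

lemma sine_mode_commute: "sine_mode N m x = sine_mode N x m"
  by (simp add: sine_mode_def case_prod_unfold discrete_sine_commute)

lemma sine_mode_boundary:
  assumes "x \<in> boundary_grid N"
  shows "sine_mode N m x = 0"
proof -
  obtain i j where "x = (i, j)" by fastforce
  with assms have "(i = 0 \<or> i = N) \<or> (j = 0 \<or> j = N)"
    by (auto simp: boundary_grid_def grid_def interior_grid_def)
  then show ?thesis
    using discrete_sine_boundary[of i N] discrete_sine_boundary[of j N]
    by (auto simp: sine_mode_def \<open>x = (i, j)\<close> case_prod_unfold)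
qed

lemma sine_mode_orthogonal:
  assumes "x \<in> interior_grid N" and "y \<in> interior_grid N"
  shows "(\<Sum>m\<in>interior_grid N. sine_mode N m x * sine_mode N m y) = (if x = y then (real N / 2)\<^sup>2 else 0)"
proof -
  obtain i j k l where xy: "x = (i, j)" "y = (k, l)" by fastforce
  have "(\<Sum>m\<in>interior_grid N. sine_mode N m x * sine_mode N m y)
    = (\<Sum>p\<in>{1..N - 1}. \<Sum>q\<in>{1..N - 1}.
        (discrete_sine N p i * discrete_sine N p k) * (discrete_sine N q j * discrete_sine N q l))"
    by (simp add: xy sine_mode_def interior_grid_def sum.cartesian_product case_prod_unfold mult_ac)
  also have "\<dots> = (\<Sum>p\<in>{1..N - 1}. discrete_sine N p i * discrete_sine N p k) *
      (\<Sum>q\<in>{1..N - 1}. discrete_sine N q j * discrete_sine N q l)"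
    by (simp only: sum_product)
  also have "\<dots> = (if i = k then real N / 2 else 0) * (if j = l then real N / 2 else 0)"
    using assms by (subst (1 2) discrete_sine_orthogonal) (auto simp: xy interior_grid_def)
  finally show ?thesis
    by (simp add: xy power2_eq_square)
qed

text \<open>
  The modes have squared norm \<open>(N / 2)\<^sup>2\<close>, so this normalisation makes \<open>sine_coeff\<close> and \<open>sine_sum\<close>
  inverse to each other on the interior points, which also index the frequencies.
\<close>

definition sine_coeff :: "nat \<Rightarrow> (nat \<times> nat \<Rightarrow> real) \<Rightarrow> nat \<times> nat \<Rightarrow> real" where
  "sine_coeff N V m = (2 / real N)\<^sup>2 * (\<Sum>x\<in>interior_grid N. V x * sine_mode N m x)"

definition sine_sum :: "nat \<Rightarrow> (nat \<times> nat \<Rightarrow> real) \<Rightarrow> nat \<times> nat \<Rightarrow> real" where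
  "sine_sum N w x = (\<Sum>m\<in>interior_grid N. w m * sine_mode N m x)"

lemma sine_sum_coeff:
  assumes "x \<in> interior_grid N"
  shows "sine_sum N (sine_coeff N V) x = V x"
proof -
  have fin: "finite (interior_grid N)" by (simp add: interior_grid_def)
  have N: "N > 0" using assms by (auto simp: interior_grid_def)
  have "sine_sum N (sine_coeff N V) x =
      (\<Sum>m\<in>interior_grid N. \<Sum>y\<in>interior_grid N. (2 / real N)\<^sup>2 * V y * (sine_mode N m y * sine_mode N m x))"
    by (simp add: sine_sum_def sine_coeff_def sum_distrib_left sum_distrib_right mult_ac)
  also have "\<dots> = (\<Sum>y\<in>interior_grid N. (2 / real N)\<^sup>2 * V y * (\<Sum>m\<in>interior_grid N. sine_mode N m y * sine_mode N m x))"
    by (subst sum.swap) (simp add: sum_distrib_left)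
  also have "\<dots> = (\<Sum>y\<in>interior_grid N. if y = x then (2 / real N)\<^sup>2 * V y * (real N / 2)\<^sup>2 else 0)"
    by (intro sum.cong refl) (simp add: sine_mode_orthogonal assms)
  also have "\<dots> = V x"
    using assms fin N by (simp add: power2_eq_square)
  finally show ?thesis .
qed

text \<open>
  The sine matrix is symmetric, so this inversion is the same computation as the previous one.
\<close>

lemma sine_coeff_sum:
  assumes "m \<in> interior_grid N"
  shows "sine_coeff N (sine_sum N w) m = w m"
proof -
  have "sine_coeff N (sine_sum N w) m = sine_sum N (sine_coeff N w) m"
    unfolding sine_coeff_def sine_sum_def sum_distrib_left
  proof (intro sum.cong refl)
    fix x
    show "(2 / real N)\<^sup>2 * ((\<Sum>y\<in>interior_grid N. w y * sine_mode N y x) * sine_mode N m x)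
      = (\<Sum>y\<in>interior_grid N. (2 / real N)\<^sup>2 * (w y * sine_mode N x y)) * sine_mode N x m"
      by (simp add: sine_mode_commute[of N _ x] sum_distrib_left mult_ac)
  qed
  then show ?thesis by (simp add: sine_sum_coeff assms)
qed

text \<open>
  The eigenvalue of the difference operator on the mode with phase increments \<open>s\<close> and \<open>t\<close> per grid step
  in the two directions.
\<close>

definition scheme_symbol :: "real \<Rightarrow> real \<Rightarrow> real \<Rightarrow> real \<Rightarrow> real" where
  "scheme_symbol K h s t =
     alpha1 K h * (4 * (sin (s / 2))\<^sup>2 / h\<^sup>2 + 4 * (sin (t / 2))\<^sup>2 / h\<^sup>2)
     - alpha2 K h * (4 * (sin (s / 2))\<^sup>2 / h\<^sup>2) * (4 * (sin (t / 2))\<^sup>2 / h\<^sup>2)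
     - K\<^sup>2 * alpha3 K h"

text \<open>
  For \<open>i = 0\<close> the truncated \<open>i - 1\<close> would give a wrong left neighbour.
\<close>

lemma sin_second_difference:
  fixes i :: nat
  assumes "1 \<le> i"
  shows "sin (real (i - 1) * s) - 2 * sin (real i * s) + sin (real (i + 1) * s)
    = - (4 * (sin (s / 2))\<^sup>2) * sin (real i * s)"
proof -
  have "sin (real (i - 1) * s) + sin (real (i + 1) * s) = 2 * sin (real i * s) * cos s"
    using assms by (simp add: of_nat_diff ring_distribs sin_add sin_diff)
  moreover have "cos s = 1 - 2 * (sin (s / 2))\<^sup>2"
    using cos_double_sin[of "s / 2"] by simp
  ultimately show ?thesis by (simp add: algebra_simps)
qed

lemma scheme_L_sine_mode:
  assumes "x \<in> interior_grid N"
  shows "scheme_L K h (sine_mode N m) x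
    = scheme_symbol K h (pi * real (fst m) / real N) (pi * real (snd m) / real N) * sine_mode N m x"
proof -
  obtain i j p q where xm: "x = (i, j)" "m = (p, q)" by fastforce
  have ij: "1 \<le> i" "1 \<le> j" using assms by (auto simp: xm interior_grid_def)
  define S T where "S = 4 * (sin ((pi * real p / real N) / 2))\<^sup>2"
    and "T = 4 * (sin ((pi * real q / real N) / 2))\<^sup>2"
  have dx: "discrete_sine N p (i - 1) - 2 * discrete_sine N p i + discrete_sine N p (i + 1) = - S * discrete_sine N p i"
    unfolding discrete_sine_def S_def by (rule sin_second_difference[OF ij(1)])
  have dy: "discrete_sine N q (j - 1) - 2 * discrete_sine N q j + discrete_sine N q (j + 1) = - T * discrete_sine N q j"
    unfolding discrete_sine_def T_def by (rule sin_second_difference[OF ij(2)])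
  have x: "delta_x2 h (sine_mode N m) x = - (S / h\<^sup>2) * sine_mode N m x"
    using dx by (simp add: delta_x2_def sine_mode_def xm) algebra
  define \<tau> where "\<tau> = T / h\<^sup>2"
  have y: "delta_y2 h (sine_mode N m) (k, j) = - \<tau> * sine_mode N m (k, j)" for k
    using dy by (simp add: delta_y2_def sine_mode_def xm \<tau>_def) algebra
  have "delta_x2 h (delta_y2 h (sine_mode N m)) x = - \<tau> * delta_x2 h (sine_mode N m) x"
    by (simp add: delta_x2_def xm y[unfolded xm] algebra_simps diff_divide_distrib add_divide_distrib)
  then show ?thesis
    using x y[of i] unfolding scheme_L_def scheme_symbol_def xm
    by (simp add: S_def T_def \<tau>_def algebra_simps)
qed

lemma scheme_L_diff:
  "scheme_L K h (\<lambda>x. U x - V x) x = scheme_L K h U x - scheme_L K h V x"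
  by (simp add: scheme_L_def delta_x2_def delta_y2_def case_prod_unfold diff_divide_distrib add_divide_distrib algebra_simps)

lemma scheme_L_add:
  "scheme_L K h (\<lambda>x. U x + V x) x = scheme_L K h U x + scheme_L K h V x"
  by (simp add: scheme_L_def delta_x2_def delta_y2_def case_prod_unfold diff_divide_distrib add_divide_distrib algebra_simps)

lemma scheme_L_scale:
  "scheme_L K h (\<lambda>x. r * U x) x = r * scheme_L K h U x"
  by (simp add: scheme_L_def delta_x2_def delta_y2_def case_prod_unfold diff_divide_distrib add_divide_distrib algebra_simps)

lemma scheme_L_sum:
  assumes "finite A"
  shows "scheme_L K h (\<lambda>x. \<Sum>m\<in>A. w m * \<phi> m x) x = (\<Sum>m\<in>A. w m * scheme_L K h (\<phi> m) x)"
  using assms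
proof (induction A rule: finite_induct)
  case empty
  show ?case using scheme_L_scale[of K h 0 "\<lambda>_. 0" x] by simp
qed (simp add: scheme_L_add scheme_L_scale)

text \<open>
  The nine-point stencil around an interior point stays inside the grid. This allows replacing a grid
  function by its sine expansion, which represents it on the grid only.
\<close>

lemma scheme_L_cong_grid:
  assumes "\<And>x. x \<in> grid N \<Longrightarrow> U x = V x" and "x \<in> interior_grid N"
  shows "scheme_L K h U x = scheme_L K h V x"
proof -
  obtain i j where x: "x = (i, j)" by fastforce
  have "k \<le> N" if "k \<in> {i - 1, i, i + 1, j - 1, j, j + 1}" for k
    using assms(2) that by (auto simp: x interior_grid_def)
  then have "U (k, l) = V (k, l)" if "k \<in> {i - 1, i, i + 1}" "l \<in> {j - 1, j, j + 1}" for k l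
    using that assms(1)[of "(k, l)"] by (auto simp: grid_def)
  then show ?thesis
    by (simp add: scheme_L_def delta_x2_def delta_y2_def x)
qed

lemma scheme_L_sine_sum:
  assumes "x \<in> interior_grid N"
  shows "scheme_L K h (sine_sum N w) x = sine_sum N (\<lambda>m. w m *
    scheme_symbol K h (pi * real (fst m) / real N) (pi * real (snd m) / real N)) x"
proof -
  have "scheme_L K h (sine_sum N w) x = (\<Sum>m\<in>interior_grid N. w m * scheme_L K h (sine_mode N m) x)"
    using scheme_L_sum[of "interior_grid N" K h w "sine_mode N" x]
    by (simp add: sine_sum_def[abs_def] interior_grid_def)
  then show ?thesis
    by (simp add: scheme_L_sine_mode[OF assms] sine_sum_def mult.assoc)
qed

text \<open>
  Subtracting an extension of the boundary data leaves a problem with zero boundary values, where the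
  operator is diagonal in the sine basis. Nonzero eigenvalues can be divided by, which gives existence,
  and cancelled in the equation for the difference of two solutions, which gives uniqueness.
\<close>

lemma discrete_dirichlet_unique_solution:
  assumes nz: "\<And>p q. p \<in> {1..N - 1} \<Longrightarrow> q \<in> {1..N - 1} \<Longrightarrow>
      scheme_symbol K h (pi * real p / real N) (pi * real q / real N) \<noteq> 0"
  shows "\<exists>!U. U \<in> extensional (grid N) \<and> (\<forall>x\<in>interior_grid N. scheme_L K h U x = F x) \<and>
      (\<forall>x\<in>boundary_grid N. U x = G x)"
proof (rule ex_ex1I)
  define \<mu> where "\<mu> m = scheme_symbol K h (pi * real (fst m) / real N) (pi * real (snd m) / real N)" for m
  have \<mu>: "\<mu> m \<noteq> 0" if "m \<in> interior_grid N" for m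
    using nz that by (auto simp: \<mu>_def interior_grid_def)
  define B where "B x = (if x \<in> boundary_grid N then G x else 0)" for x
  define w where "w m = sine_coeff N (\<lambda>x. F x - scheme_L K h B x) m / \<mu> m" for m
  define U where "U = restrict (\<lambda>x. B x + sine_sum N w x) (grid N)"
  have "scheme_L K h U x = F x" if x: "x \<in> interior_grid N" for x
  proof -
    have "scheme_L K h U x = scheme_L K h (\<lambda>x. B x + sine_sum N w x) x"
      by (rule scheme_L_cong_grid[OF _ x]) (simp add: U_def)
    also have "\<dots> = scheme_L K h B x + sine_sum N (\<lambda>m. w m * \<mu> m) x"
      by (simp add: scheme_L_add scheme_L_sine_sum[OF x] \<mu>_def)
    also have "sine_sum N (\<lambda>m. w m * \<mu> m) x = sine_sum N (sine_coeff N (\<lambda>x. F x - scheme_L K h B x)) x"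
      unfolding sine_sum_def by (intro sum.cong refl) (simp add: w_def \<mu>)
    finally show ?thesis by (simp add: sine_sum_coeff[OF x])
  qed
  moreover have "U x = G x" if "x \<in> boundary_grid N" for x
    using that by (simp add: U_def B_def sine_sum_def sine_mode_boundary) (simp add: boundary_grid_def)
  ultimately show "\<exists>U. U \<in> extensional (grid N) \<and> (\<forall>x\<in>interior_grid N. scheme_L K h U x = F x) \<and>
      (\<forall>x\<in>boundary_grid N. U x = G x)"
    by (intro exI[of _ U]) (auto simp: U_def)
next
  fix U V
  assume U: "U \<in> extensional (grid N) \<and> (\<forall>x\<in>interior_grid N. scheme_L K h U x = F x) \<and>
      (\<forall>x\<in>boundary_grid N. U x = G x)"
    and V: "V \<in> extensional (grid N) \<and> (\<forall>x\<in>interior_grid N. scheme_L K h V x = F x) \<and>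
      (\<forall>x\<in>boundary_grid N. V x = G x)"
  define \<mu> where "\<mu> m = scheme_symbol K h (pi * real (fst m) / real N) (pi * real (snd m) / real N)" for m
  define W where "W x = U x - V x" for x
  define w where "w = sine_coeff N W"
  have expand: "W x = sine_sum N w x" if "x \<in> grid N" for x
  proof (cases "x \<in> interior_grid N")
    case True
    then show ?thesis by (simp add: w_def sine_sum_coeff)
  next
    case False
    then have "x \<in> boundary_grid N" using that by (simp add: boundary_grid_def)
    then show ?thesis
      using U V by (simp add: W_def sine_sum_def sine_mode_boundary)
  qed
  have zero: "sine_sum N (\<lambda>m. w m * \<mu> m) x = 0" if x: "x \<in> interior_grid N" for x
  proof -
    have "sine_sum N (\<lambda>m. w m * \<mu> m) x = scheme_L K h W x"
      using scheme_L_cong_grid[OF expand x] by (simp add: scheme_L_sine_sum[OF x] \<mu>_def)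
    also have "\<dots> = 0"
      using U V x by (simp add: W_def[abs_def] scheme_L_diff)
    finally show ?thesis .
  qed
  have "w m = 0" if m: "m \<in> interior_grid N" for m
  proof -
    have "w m * \<mu> m = sine_coeff N (sine_sum N (\<lambda>m. w m * \<mu> m)) m"
      by (simp add: sine_coeff_sum[OF m])
    also have "\<dots> = 0" by (simp add: sine_coeff_def zero)
    finally show ?thesis
      using nz m by (auto simp: \<mu>_def interior_grid_def)
  qed
  then have "W x = 0" if "x \<in> grid N" for x
    using expand[OF that] by (simp add: sine_sum_def)
  then show "U = V"
    using U V by (intro extensionalityI[of _ "grid N"]) (auto simp: W_def)
qed

section \<open>The eigenvalues do not vanish on fine grids\<close>

text \<open>
  Multiplication by \<open>h\<^sup>2\<close> removes all negative powers of \<open>h\<close>. For phases proportional to \<open>h\<close> the right-hand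
  side is thus an entire function of \<open>h\<close>.
\<close>

lemma scheme_symbol_scaled:
  assumes "h \<noteq> 0"
  shows "h\<^sup>2 * scheme_symbol K h s t =
     (1 + (K * h) ^ 6 / 20160) * (4 * ((sin (s / 2))\<^sup>2 + (sin (t / 2))\<^sup>2))
     - 8 / 3 * (1 + (K * h) ^ 2 / 30 + (K * h) ^ 4 / 840) * ((sin (s / 2))\<^sup>2 * (sin (t / 2))\<^sup>2)
     - (K * h) ^ 2 * (1 - (K * h) ^ 2 / 12 + (K * h) ^ 4 / 360)"
proof -
  define A B where "A = (sin (s / 2))\<^sup>2 / h\<^sup>2" and "B = (sin (t / 2))\<^sup>2 / h\<^sup>2"
  have "(sin (s / 2))\<^sup>2 = A * h\<^sup>2" "(sin (t / 2))\<^sup>2 = B * h\<^sup>2"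
    using assms by (simp_all add: A_def B_def)
  moreover have "scheme_symbol K h s t = alpha1 K h * (4 * A + 4 * B) - alpha2 K h * (4 * A) * (4 * B) - K\<^sup>2 * alpha3 K h"
    by (simp add: scheme_symbol_def A_def B_def)
  ultimately show ?thesis
    by (simp add: alpha1_def alpha2_def alpha3_def field_simps) algebra
qed

lemma alpha3_factor_pos: "0 < 1 - x\<^sup>2 / 12 + x ^ 4 / (360 :: real)"
proof -
  have "1 - x\<^sup>2 / 12 + x ^ 4 / 360 = (x\<^sup>2 - 15)\<^sup>2 / 360 + 3 / 8"
    by (simp add: power2_eq_square power4_eq_xxxx field_simps)
  then show ?thesis
    by (simp add: add_nonneg_pos)
qed

text \<open>
  A point \<open>T\<close> at which both sines vanish, however large, shows that the entire function of
  \<open>scheme_symbol_scaled\<close> is not identically zero, as \<open>\<alpha>\<^sub>3\<close> has no real zero. Hence \<open>0\<close> has a punctured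
  neighbourhood without zeros.
\<close>

lemma scheme_symbol_eventually_nonzero:
  assumes K: "K \<noteq> 0" and T: "T \<noteq> 0" "sin (\<alpha> * T) = 0" "sin (\<beta> * T) = 0"
  shows "\<forall>\<^sub>F h in at_right 0. scheme_symbol K h (2 * \<alpha> * h) (2 * \<beta> * h) \<noteq> 0"
proof -
  define g :: "complex \<Rightarrow> complex" where "g z =
     (1 + (of_real K * z) ^ 6 / 20160) * (4 * ((sin (of_real \<alpha> * z))\<^sup>2 + (sin (of_real \<beta> * z))\<^sup>2))
     - 8 / 3 * (1 + (of_real K * z) ^ 2 / 30 + (of_real K * z) ^ 4 / 840) * ((sin (of_real \<alpha> * z))\<^sup>2 * (sin (of_real \<beta> * z))\<^sup>2)
     - (of_real K * z) ^ 2 * (1 - (of_real K * z) ^ 2 / 12 + (of_real K * z) ^ 4 / 360)" for z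
  have symbol: "of_real (h\<^sup>2 * scheme_symbol K h (2 * \<alpha> * h) (2 * \<beta> * h)) = g (of_real h)" if "h \<noteq> 0" for h
    unfolding scheme_symbol_scaled[OF that] g_def by (simp add: sin_of_real[symmetric])
  have "sin (of_real \<alpha> * of_real T :: complex) = 0" "sin (of_real \<beta> * of_real T :: complex) = 0"
    using T by (metis of_real_0 of_real_mult sin_of_real)+
  then have "g (of_real T) = of_real (- (K * T)\<^sup>2 * (1 - (K * T)\<^sup>2 / 12 + (K * T) ^ 4 / 360))"
    unfolding g_def by simp
  then have "g (of_real T) \<noteq> 0"
    using alpha3_factor_pos[of "K * T"] K T(1) by (simp only: of_real_eq_0_iff) simp
  then have "\<forall>\<^sub>F z in at 0. g z \<noteq> 0 \<and> z \<in> UNIV"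
    by (intro non_zero_neighbour_alt[where \<beta> = "of_real T"])
       (auto simp: g_def intro!: holomorphic_intros)
  then obtain d where d: "d > 0" "\<And>z. z \<noteq> 0 \<Longrightarrow> dist z 0 < d \<Longrightarrow> g z \<noteq> 0"
    by (auto simp: eventually_at)
  have "scheme_symbol K h (2 * \<alpha> * h) (2 * \<beta> * h) \<noteq> 0" if "0 < h" "h < d" for h
    using d(2)[of "of_real h"] symbol[of h] that by auto
  then show ?thesis
    using d(1) by (auto simp: eventually_at_right_field)
qed

text \<open>
  Write \<open>S\<close> and \<open>T\<close> for the squared sines. Since \<open>S, T \<le> 1\<close>, we have \<open>2 S T \<le> S + T\<close>. For \<open>\<bar>K h\<bar> \<le> 1\<close> the
  mixed term is then at most \<open>14/5 S T \<le> 7/5 (S + T)\<close>, well below the main term \<open>4 (S + T)\<close>, and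
  \<open>\<alpha>\<^sub>3 \<le> 1\<close>.
\<close>

lemma scheme_symbol_pos:
  assumes h: "h \<noteq> 0" and "\<bar>K * h\<bar> \<le> 1"
    and dominant: "(K * h)\<^sup>2 < 2 * ((sin (s / 2))\<^sup>2 + (sin (t / 2))\<^sup>2)"
  shows "scheme_symbol K h s t > 0"
proof -
  define x S T where "x = K * h" and "S = (sin (s / 2))\<^sup>2" and "T = (sin (t / 2))\<^sup>2"
  have ST: "0 \<le> S" "S \<le> 1" "0 \<le> T" "T \<le> 1"
    by (simp_all add: S_def T_def abs_square_le_1)
  have x2: "x\<^sup>2 \<le> 1" using assms(2) by (simp add: x_def abs_square_le_1)
  have x4: "x ^ 4 \<le> x\<^sup>2"
    using mult_right_mono[OF x2, of "x\<^sup>2"] by (simp add: power2_eq_square power4_eq_xxxx)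
  have 1: "4 * (S + T) \<le> (1 + x ^ 6 / 20160) * (4 * (S + T))"
    using ST by (simp add: ring_distribs zero_le_even_power)
  have 2: "8 / 3 * (1 + x\<^sup>2 / 30 + x ^ 4 / 840) * (S * T) \<le> 14 / 5 * (S * T)"
    using ST x2 x4 by (intro mult_right_mono) auto
  have 3: "x\<^sup>2 * (1 - x\<^sup>2 / 12 + x ^ 4 / 360) \<le> x\<^sup>2 * 1"
    using x4 zero_le_power2[of x] by (intro mult_left_mono) linarith+
  have "2 * (S * T) \<le> S + T"
    using mult_left_le[of T S] mult_left_le[of S T] ST by (simp add: mult.commute)
  then have "0 < 4 * (S + T) - 14 / 5 * (S * T) - x\<^sup>2 * 1"
    using dominant ST(1,3) unfolding x_def[symmetric] S_def[symmetric] T_def[symmetric]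
    by (simp add: distrib_left)
  also have "\<dots> \<le> h\<^sup>2 * scheme_symbol K h s t"
    unfolding scheme_symbol_scaled[OF h] x_def[symmetric] S_def[symmetric] T_def[symmetric]
    by (intro diff_mono 1 2 3)
  finally show ?thesis by (simp add: zero_less_mult_iff)
qed

lemma sin_ge_half:
  assumes "0 \<le> x" and "x \<le> pi / 2"
  shows "x / 2 \<le> sin (x :: real)"
proof -
  have "\<bar>sin x - (\<Sum>m<3. sin_coeff m * x ^ m)\<bar> \<le> inverse (fact 3) * \<bar>x\<bar> ^ 3"
    by (rule Maclaurin_sin_bound)
  then have "(\<Sum>m<3. sin_coeff m * x ^ m) - inverse (fact 3) * \<bar>x\<bar> ^ 3 \<le> sin x"
    by linarith
  then have "x - x ^ 3 / 6 \<le> sin x"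
    using assms by (simp add: sin_coeff_def numeral_eq_Suc fact_numeral)
  moreover have "x * x\<^sup>2 \<le> x * 3"
  proof (rule mult_left_mono)
    have "x \<le> 17 / 10" using assms pi_less_4 pi_approx by simp
    then have "x\<^sup>2 \<le> (17 / 10)\<^sup>2" using assms by (intro power_mono) auto
    then show "x\<^sup>2 \<le> 3" by (simp add: power2_eq_square)
  qed fact
  ultimately show ?thesis by (simp add: power3_eq_cube power2_eq_square)
qed

text \<open>
  Used with \<open>k = K L\<close> and \<open>r = h / L\<close>: the modes of frequency \<open>p > K L\<close> satisfy the hypothesis of
  \<open>scheme_symbol_pos\<close>. With \<open>\<pi> > 3\<close> the sine is at least \<open>3/4 p r\<close>, and \<open>2 (3/4)\<^sup>2 > 1\<close>.
\<close>

lemma sin_squared_high_frequency: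
  fixes k r :: real
  assumes r: "0 < r" and p: "k < p" "0 \<le> k" "p * r \<le> 1"
  shows "(k * r)\<^sup>2 < 2 * (sin (pi * (p * r) / 2))\<^sup>2"
proof -
  have "0 \<le> p * r" using assms by simp
  have "3 * (p * r) \<le> pi * (p * r)"
    using pi_gt3 \<open>0 \<le> p * r\<close> by (intro mult_right_mono) auto
  moreover have "pi * (p * r) / 2 / 2 \<le> sin (pi * (p * r) / 2)"
    using p \<open>0 \<le> p * r\<close> by (intro sin_ge_half) auto
  ultimately have "(3 / 4 * (p * r))\<^sup>2 \<le> (sin (pi * (p * r) / 2))\<^sup>2"
    using \<open>0 \<le> p * r\<close> by (intro power_mono) auto
  moreover have "(k * r)\<^sup>2 < (p * r)\<^sup>2"
    using assms by (intro power_strict_mono mult_strict_right_mono) auto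
  moreover have "(3 / 4 * (p * r))\<^sup>2 = 9 / 16 * (p * r)\<^sup>2"
    by (simp add: power_mult_distrib power_divide)
  ultimately show ?thesis
    using zero_le_power2[of "sin (pi * (p * r) / 2)"] by linarith
qed

text \<open>
  A single threshold for \<open>h\<close> serves all frequencies: the positive lower bound covers those above \<open>K L\<close>,
  and the finitely many others contribute one threshold each. The conditions \<open>p h, q h \<le> L\<close>, which say
  that \<open>p, q \<le> N\<close> when \<open>L = N h\<close>, keep half the phase within \<open>{0..\<pi>/2}\<close>.
\<close>

lemma eventually_all_scheme_symbols_nonzero:
  assumes "K > 0" and "L > 0"
  shows "\<forall>\<^sub>F h in at_right 0. \<forall>p q :: nat. real p * h \<le> L \<longrightarrow> real q * h \<le> L \<longrightarrow>
           scheme_symbol K h (pi * real p * h / L) (pi * real q * h / L) \<noteq> 0"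
proof -
  \<comment> \<open>up to \<open>M\<close> the sines need not outweigh \<open>(K h)\<^sup>2\<close>; these finitely many frequencies share one threshold\<close>
  obtain M :: nat where M: "K * L < real M"
    using reals_Archimedean2 by blast
  have "\<forall>\<^sub>F h in at_right 0. scheme_symbol K h (pi * real p * h / L) (pi * real q * h / L) \<noteq> 0" for p q :: nat
  proof -
    have "\<forall>\<^sub>F h in at_right 0. scheme_symbol K h (2 * (pi * real p / (2 * L)) * h) (2 * (pi * real q / (2 * L)) * h) \<noteq> 0"
      using assms by (intro scheme_symbol_eventually_nonzero[where T = "2 * L"]) (auto simp: mult.commute[of pi])
    then show ?thesis by simp
  qed
  then have low: "\<forall>\<^sub>F h in at_right 0. \<forall>m\<in>{..M} \<times> {..M}.
      scheme_symbol K h (pi * real (fst m) * h / L) (pi * real (snd m) * h / L) \<noteq> 0"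
    by (intro eventually_ball_finite) auto
  have "\<forall>\<^sub>F h in at_right 0. 0 < h \<and> h < 1 / K"
    using assms by (auto simp: eventually_at_right_field intro!: exI[of _ "1 / K"])
  with low show ?thesis
  proof eventually_elim
    case (elim h)
    have "0 < K * h" using elim assms by simp
    then have small: "\<bar>K * h\<bar> \<le> 1" using elim assms by (simp add: field_simps)
    have high: "(K * h)\<^sup>2 < 2 * (sin (pi * real p * h / L / 2))\<^sup>2"
      if "M < p" "real p * h \<le> L" for p :: nat
      using sin_squared_high_frequency[of "h / L" "K * L" "real p"] that elim assms M by (simp add: mult.assoc)
    show ?case
    proof (intro allI impI)
      fix p q :: nat
      assume pq: "real p * h \<le> L" "real q * h \<le> L"
      show "scheme_symbol K h (pi * real p * h / L) (pi * real q * h / L) \<noteq> 0"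
      proof (cases "p \<le> M \<and> q \<le> M")
        case True
        then show ?thesis using elim(1)[rule_format, of "(p, q)"] by simp
      next
        case False
        then have "M < p \<or> M < q" by auto
        then have "(K * h)\<^sup>2 < 2 * ((sin (pi * real p * h / L / 2))\<^sup>2 + (sin (pi * real q * h / L / 2))\<^sup>2)"
          using high[OF _ pq(1)] high[OF _ pq(2)]
            zero_le_power2[of "sin (pi * real p * h / L / 2)"] zero_le_power2[of "sin (pi * real q * h / L / 2)"]
          unfolding distrib_left by linarith
        then show ?thesis
          using scheme_symbol_pos[of h K] small elim(2) by fastforce
      qed
    qed
  qed
qed

theorem theorem4p3:
  fixes a b c d K :: real
  assumes "a < b" and "c < d"
  shows "\<exists>\<epsilon>>0. \<forall>(N::nat) (h::real) (f :: real \<Rightarrow> real \<Rightarrow> real) (\<Phi> :: real \<Rightarrow> real \<Rightarrow> real).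
           a + real N * h = b \<longrightarrow> c + real N * h = d \<longrightarrow>
           0 < K * h \<longrightarrow> K * h < \<epsilon> \<longrightarrow>
           C_on_rect 2 a b c d f \<longrightarrow>
           (\<exists>!U. scheme_solution a b c d K N h f \<Phi> U)"
proof (cases "K > 0")
  case True
  then obtain \<delta> where \<delta>: "\<delta> > 0" "\<And>h p q. 0 < h \<Longrightarrow> h < \<delta> \<Longrightarrow>
      real p * h \<le> b - a \<Longrightarrow> real q * h \<le> b - a \<Longrightarrow>
      scheme_symbol K h (pi * real p * h / (b - a)) (pi * real q * h / (b - a)) \<noteq> 0"
    using eventually_all_scheme_symbols_nonzero[of K "b - a"] \<open>a < b\<close>
    unfolding eventually_at_right_field by (metis diff_gt_0_iff_gt)
  show ?thesis
  proof (intro exI[of _ "K * \<delta>"] conjI allI impI)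
    show "K * \<delta> > 0" using True \<delta>(1) by simp
    fix N :: nat and h :: real and f \<Phi> :: "real \<Rightarrow> real \<Rightarrow> real"
    assume N: "a + real N * h = b" and "0 < K * h" "K * h < K * \<delta>"
    then have h: "0 < h" "h < \<delta>" using True by (simp_all add: zero_less_mult_iff)
    have L: "b - a = real N * h" using N by simp
    then have "N > 0" using \<open>a < b\<close> by (cases N) auto
    have "scheme_symbol K h (pi * real p / real N) (pi * real q / real N) \<noteq> 0"
      if "p \<in> {1..N - 1}" "q \<in> {1..N - 1}" for p q
    proof -
      have "p \<le> N" "q \<le> N" using that by auto
      then show ?thesis using \<delta>(2)[OF h, of p q] that h by (simp add: L)
    qed
    then show "\<exists>!U. scheme_solution a b c d K N h f \<Phi> U"
      unfolding scheme_solution_def by (rule discrete_dirichlet_unique_solution)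
  qed
next
  case False
  \<comment> \<open>the step is positive because \<open>a < b\<close>, so \<open>0 < K * h\<close> is impossible\<close>
  have "h > 0" if "a + real N * h = b" for N h
    using that \<open>a < b\<close> by (smt (verit) mult_nonneg_nonpos of_nat_0_le_iff)
  then have "\<not> 0 < K * h" if "a + real N * h = b" for N h
    using that False by (smt (verit) mult_nonpos_nonneg)
  then show ?thesis
    by (intro exI[of _ 1]) auto
qed

end
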